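(* Let $f,g,\phi$ satisfy the composite smoothness assumption and the bounded domain assumption for some $\Omega\ge0$, let the saddle-subdifferential operator $M=(\nabla_u\phi+\partial f,\,-\nabla_v\phi+\partial g)$ of the problem $\min_{u}\max_{v}\{f(u)+\phi(u,v)-g(v)\}$ satisfy the weak MVI condition for some $\rho\in\big[0,\frac{1}{2L+\hat L}\big)$, and let $\tau\in\big(\frac{\rho}{1-\rho L},\frac{1}{L+\hat L}\big)$. Then the SA-MGDA method finds an $\epsilon$-stationary point, i.e. a point $x$ (among its iterates) satisfying $\min_{s\in MRx}\|s\|^2\le\epsilon$, with $k=O(\epsilon^{-1})$ outer iterations and $J=O(\log(\epsilon^{-1}))$ inner iterations per outer iteration, requiring in total $O(\epsilon^{-1}\log\epsilon^{-1})$ gradient computations.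
   Context: Let $d=d_u+d_v$, $x=(u,v)\in\mathbb{R}^{d_u}\times\mathbb{R}^{d_v}=\mathbb{R}^d$ with Euclidean inner product and norm. The $O(\cdot)$ is as $\epsilon\to0^+$, with the problem data, $\tau$ and the initial point fixed. Composite smoothness assumption: $f:\mathbb{R}^{d_u}\to(-\infty,\infty]$ and $g:\mathbb{R}^{d_v}\to(-\infty,\infty]$ are closed, proper and convex; $\phi:\mathbb{R}^d\to\mathbb{R}$ is continuously differentiable and there are $L_{uu},L_{uv},L_{vu},L_{vv}>0$ with $\|\nabla_u\phi(u,v)-\nabla_u\phi(\bar u,\bar v)\|\le L_{uu}\|u-\bar u\|+L_{uv}\|v-\bar v\|$ and $\|\nabla_v\phi(u,v)-\nabla_v\phi(\bar u,\bar v)\|\le L_{vu}\|u-\bar u\|+L_{vv}\|v-\bar v\|$ for all $u,\bar u,v,\bar v$. $L>0$ denotes a Lipschitz constant of $\nabla\phi$ (equivalently of $(\nabla_u\phi,-\nabla_v\phi)$) on $\mathbb{R}^d$, and $\hat L=\max\{L_{uu},L_{vv}\}$. Bounded domain assumption: $\|x-y\|\le\Omega$ for all $x,y\in\operatorname{dom}f\times\operatorname{dom}g$. $\operatorname{gra}M=\{(x,w):w\in Mx\}$; $X_*(M)=\{x_*:0\in Mx_*\}$ (assumed nonempty). Weak MVI condition with $\rho\ge0$: there exists $x_*\in X_*(M)$ such that $\langle x-x_*,w\rangle\ge-\frac\rho2\|w\|^2$ for all $(x,w)\in\operatorname{gra}M$. Let $h(u,v)=\frac{1}{2\tau}(\|u\|^2+\|v\|^2)-\phi(u,v)$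 and let $R=(\nabla h+M)^{-1}\nabla h$ be the $h$-resolvent of $M$ ($y=Rx$ iff $\nabla h(x)-\nabla h(y)\in My$), which is single-valued on $\mathbb{R}^d$ for the given $\tau$. SA-MGDA with finite $J\ge1$: let $\eta=\frac{\tau}{1+2L_{vv}\tau}$ and $\operatorname{prox}_\psi=(I+\partial\psi)^{-1}$. From an initial point $x_0=(u_0,v_0)$, for outer iterations $k=0,1,\dots$: set $u_{k+1}=\operatorname{prox}_{\tau f}[u_k-\tau\nabla_u\phi(u_k,v_k)]$ and $v_{k,0}=v_k$; for inner iterations $j=0,\dots,J-1$ set $v_{k,j+1}=\operatorname{prox}_{\eta g}\big[\frac\eta\tau(v_k-\tau\nabla_v\phi(u_k,v_k))+2\eta L_{vv}\big(v_{k,j}+\frac1{L_{vv}}\nabla_v\phi(u_{k+1},v_{k,j})\big)\big]$; then $v_{k+1}=v_{k,J}$ and $x_{k+1}=(u_{k+1},v_{k+1})$. A gradient computation is an evaluation of $\nabla_u\phi$ or $\nabla_v\phi$ at a point. *)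

theory Defs
  imports "HOL-Analysis.Analysis" "HOL-Library.Landau_Symbols"
begin

section \<open>Extended-real convex functions\<close>

definition dom_fun :: "('a \<Rightarrow> ereal) \<Rightarrow> 'a set" where
  "dom_fun f = {x. f x < \<infinity>}"

definition epi :: "('a \<Rightarrow> ereal) \<Rightarrow> ('a \<times> real) set" where
  "epi f = {(x, r). f x \<le> ereal r}"

text \<open>A function into the extended reals is convex (closed) if its epigraph is convex (closed).\<close>

definition closed_proper_convex :: "('a::euclidean_space \<Rightarrow> ereal) \<Rightarrow> bool" where
  "closed_proper_convex f \<longleftrightarrow>
     (\<forall>x. f x \<noteq> -\<infinity>) \<and> dom_fun f \<noteq> {} \<and> convex (epi f) \<and> closed (epi f)"

text \<open>For proper \<open>f\<close> the set below is empty outside \<open>dom_fun f\<close>.\<close>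

definition subdifferential :: "('a::euclidean_space \<Rightarrow> ereal) \<Rightarrow> 'a \<Rightarrow> 'a set" where
  "subdifferential f x = {s. \<forall>y. f x + ereal (s \<bullet> (y - x)) \<le> f y}"

text \<open>\<open>prox \<psi> = (I + \<partial>\<psi>)\<inverse>\<close>, which is single-valued and total on the whole space for closed,
  proper, convex \<open>\<psi>\<close>.\<close>

definition prox :: "('a::euclidean_space \<Rightarrow> ereal) \<Rightarrow> 'a \<Rightarrow> 'a" where
  "prox \<psi> z = (THE p. z \<in> {p + s | s. s \<in> subdifferential \<psi> p})"

section \<open>Gradients and composite smoothness\<close>

definition gradient :: "('a::euclidean_space \<Rightarrow> real) \<Rightarrow> 'a \<Rightarrow> 'a" where
  "gradient F x = (THE D. GDERIV F x :> D)"

definition grad_u :: "('u::euclidean_space \<times> 'v::euclidean_space \<Rightarrow> real) \<Rightarrow> 'u \<times> 'v \<Rightarrow> 'u" where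
  "grad_u \<phi> x = gradient (\<lambda>u. \<phi> (u, snd x)) (fst x)"

definition grad_v :: "('u::euclidean_space \<times> 'v::euclidean_space \<Rightarrow> real) \<Rightarrow> 'u \<times> 'v \<Rightarrow> 'v" where
  "grad_v \<phi> x = gradient (\<lambda>v. \<phi> (fst x, v)) (snd x)"

definition composite_smooth ::
  "('u::euclidean_space \<Rightarrow> ereal) \<Rightarrow> ('v::euclidean_space \<Rightarrow> ereal) \<Rightarrow> ('u \<times> 'v \<Rightarrow> real)
    \<Rightarrow> real \<Rightarrow> real \<Rightarrow> real \<Rightarrow> real \<Rightarrow> bool" where
  "composite_smooth f g \<phi> Luu Luv Lvu Lvv \<longleftrightarrow>
     closed_proper_convex f \<and> closed_proper_convex g \<and>
     (\<forall>x. \<phi> differentiable (at x)) \<and> continuous_on UNIV (gradient \<phi>) \<and>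
     Luu > 0 \<and> Luv > 0 \<and> Lvu > 0 \<and> Lvv > 0 \<and>
     (\<forall>u u' v v'. norm (grad_u \<phi> (u, v) - grad_u \<phi> (u', v'))
        \<le> Luu * norm (u - u') + Luv * norm (v - v')) \<and>
     (\<forall>u u' v v'. norm (grad_v \<phi> (u, v) - grad_v \<phi> (u', v'))
        \<le> Lvu * norm (u - u') + Lvv * norm (v - v'))"

definition bounded_domain ::
  "('u::euclidean_space \<Rightarrow> ereal) \<Rightarrow> ('v::euclidean_space \<Rightarrow> ereal) \<Rightarrow> real \<Rightarrow> bool" where
  "bounded_domain f g \<Omega> \<longleftrightarrow>
     (\<forall>x \<in> dom_fun f \<times> dom_fun g. \<forall>y \<in> dom_fun f \<times> dom_fun g. norm (x - y) \<le> \<Omega>)"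

section \<open>Operators\<close>

definition saddle_op ::
  "('u::euclidean_space \<Rightarrow> ereal) \<Rightarrow> ('v::euclidean_space \<Rightarrow> ereal) \<Rightarrow> ('u \<times> 'v \<Rightarrow> real)
    \<Rightarrow> 'u \<times> 'v \<Rightarrow> ('u \<times> 'v) set" where
  "saddle_op f g \<phi> x =
     {(grad_u \<phi> x + s, - grad_v \<phi> x + t) | s t.
        s \<in> subdifferential f (fst x) \<and> t \<in> subdifferential g (snd x)}"

definition gra :: "('a \<Rightarrow> 'a set) \<Rightarrow> ('a \<times> 'a) set" where
  "gra M = {(x, w). w \<in> M x}"

definition zeros :: "('a::zero \<Rightarrow> 'a set) \<Rightarrow> 'a set" where
  "zeros M = {x. 0 \<in> M x}"

definition weak_MVI :: "('a::euclidean_space \<Rightarrow> 'a set) \<Rightarrow> real \<Rightarrow> bool" where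
  "weak_MVI M \<rho> \<longleftrightarrow>
     (\<exists>xs \<in> zeros M. \<forall>(x, w) \<in> gra M. (x - xs) \<bullet> w \<ge> - (\<rho> / 2) * (norm w)\<^sup>2)"

definition resolvent_kernel ::
  "real \<Rightarrow> ('u::euclidean_space \<times> 'v::euclidean_space \<Rightarrow> real) \<Rightarrow> 'u \<times> 'v \<Rightarrow> real" where
  "resolvent_kernel \<tau> \<phi> = (\<lambda>(u, v). 1 / (2 * \<tau>) * ((norm u)\<^sup>2 + (norm v)\<^sup>2) - \<phi> (u, v))"

definition resolvent ::
  "('a::euclidean_space \<Rightarrow> real) \<Rightarrow> ('a \<Rightarrow> 'a set) \<Rightarrow> 'a \<Rightarrow> 'a" where
  "resolvent h M x = (THE y. gradient h x - gradient h y \<in> M y)"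

text \<open>That the minimum of \<open>\<parallel>s\<parallel>\<^sup>2\<close> over \<open>M (R x)\<close> is attained is part of the definition.\<close>

definition eps_stationary ::
  "('a::euclidean_space \<Rightarrow> 'a set) \<Rightarrow> ('a \<Rightarrow> 'a) \<Rightarrow> real \<Rightarrow> 'a \<Rightarrow> bool" where
  "eps_stationary M R \<epsilon> x \<longleftrightarrow>
     (\<exists>s. is_arg_min (\<lambda>s. (norm s)\<^sup>2) (\<lambda>s. s \<in> M (R x)) s \<and> (norm s)\<^sup>2 \<le> \<epsilon>)"

section \<open>The method SA-MGDA\<close>

text \<open>Each function returns its result together with the number of gradient evaluations made.
  The value \<open>b = \<nabla>\<^sub>v \<phi> (u\<^sub>k, v\<^sub>k)\<close> does not change during the inner loop and is evaluated once per
  outer iteration.\<close>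

primrec sa_mgda_inner ::
  "('v::euclidean_space \<Rightarrow> ereal) \<Rightarrow> ('u::euclidean_space \<times> 'v \<Rightarrow> real) \<Rightarrow> real \<Rightarrow> real
    \<Rightarrow> 'u \<Rightarrow> 'v \<Rightarrow> 'v \<Rightarrow> nat \<Rightarrow> 'v \<times> nat" where
  "sa_mgda_inner g \<phi> \<tau> Lvv u' v b 0 = (v, 0)"
| "sa_mgda_inner g \<phi> \<tau> Lvv u' v b (Suc j) =
     (let \<eta> = \<tau> / (1 + 2 * Lvv * \<tau>);
          (w, n) = sa_mgda_inner g \<phi> \<tau> Lvv u' v b j;
          c = grad_v \<phi> (u', w)
      in (prox (\<lambda>y. ereal \<eta> * g y)
            ((\<eta> / \<tau>) *\<^sub>R (v - \<tau> *\<^sub>R b) + (2 * \<eta> * Lvv) *\<^sub>R (w + (1 / Lvv) *\<^sub>R c)),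
          n + 1))"

definition sa_mgda_step ::
  "('u::euclidean_space \<Rightarrow> ereal) \<Rightarrow> ('v::euclidean_space \<Rightarrow> ereal) \<Rightarrow> ('u \<times> 'v \<Rightarrow> real)
    \<Rightarrow> real \<Rightarrow> real \<Rightarrow> nat \<Rightarrow> 'u \<times> 'v \<Rightarrow> ('u \<times> 'v) \<times> nat" where
  "sa_mgda_step f g \<phi> \<tau> Lvv J = (\<lambda>(u, v).
     let a = grad_u \<phi> (u, v);
         b = grad_v \<phi> (u, v);
         u' = prox (\<lambda>y. ereal \<tau> * f y) (u - \<tau> *\<^sub>R a);
         (v', n) = sa_mgda_inner g \<phi> \<tau> Lvv u' v b J
     in ((u', v'), 2 + n))"

primrec sa_mgda_run ::
  "('u::euclidean_space \<Rightarrow> ereal) \<Rightarrow> ('v::euclidean_space \<Rightarrow> ereal) \<Rightarrow> ('u \<times> 'v \<Rightarrow> real)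
    \<Rightarrow> real \<Rightarrow> real \<Rightarrow> nat \<Rightarrow> 'u \<times> 'v \<Rightarrow> nat \<Rightarrow> ('u \<times> 'v) \<times> nat" where
  "sa_mgda_run f g \<phi> \<tau> Lvv J x0 0 = (x0, 0)"
| "sa_mgda_run f g \<phi> \<tau> Lvv J x0 (Suc k) =
     (let (x, m) = sa_mgda_run f g \<phi> \<tau> Lvv J x0 k;
          (x', n) = sa_mgda_step f g \<phi> \<tau> Lvv J x
      in (x', m + n))"

definition sa_mgda_iterate where
  "sa_mgda_iterate f g \<phi> \<tau> Lvv J x0 k = fst (sa_mgda_run f g \<phi> \<tau> Lvv J x0 k)"

definition sa_mgda_gradients where
  "sa_mgda_gradients f g \<phi> \<tau> Lvv J x0 k = snd (sa_mgda_run f g \<phi> \<tau> Lvv J x0 k)"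

end

theory Submission imports Defs begin

text \<open>
  The method is an inexact Bregman proximal point iteration for the saddle-subdifferential operator
  \<open>M\<close>, with kernel \<open>h = \<parallel>\<cdot>\<parallel>\<^sup>2 / (2\<tau>) - \<phi>\<close>. Although \<open>\<phi>\<close> may be neither convex nor
  concave, \<open>1/\<tau> > L\<close> makes \<open>h\<close> convex, and \<open>h\<close> is \<open>\<beta>\<close>-smooth with \<open>\<beta> = 1/\<tau> + L\<close>.

  One exact step \<open>y = R x\<close> produces \<open>s = \<nabla>h(x) - \<nabla>h(y) \<in> M y\<close>. By the three-point identity, the
  Bregman distance from \<open>xs\<close>, the zero given by the weak MVI condition, falls by
  \<open>bregman h y x + \<langle>y - xs, s\<rangle>\<close>. The first summand is at least \<open>\<parallel>s\<parallel>\<^sup>2 / (2\<beta>)\<close> by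
  cocoercivity (\<open>bregman_ge_gradient_diff\<close>), the second at least \<open>- \<rho> \<parallel>s\<parallel>\<^sup>2 / 2\<close> by
  assumption. The lower bound on \<open>\<tau>\<close> says precisely that \<open>\<rho> < 1/\<beta>\<close>, so the decrease is at least
  \<open>\<delta> \<parallel>s\<parallel>\<^sup>2\<close> for some \<open>\<delta> > 0\<close> (\<open>resolvent_decrease\<close>).

  Written in components, the inclusion that defines \<open>R x\<close> is an explicit proximal step in \<open>u\<close>
  and an implicit equation in \<open>v\<close> (\<open>resolvent_inclusion_iff\<close>). The implicit equation is the fixed
  point equation of the inner map, which is a contraction with some factor \<open>q < 1\<close>
  (\<open>v_map_contraction\<close>). So \<open>R\<close> is well defined by Banach's theorem, and \<open>J\<close> inner steps
  leave an error of order \<open>q ^ J\<close> (\<open>inner_loop_error\<close>). On the bounded domain this error costs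
  the potential at most \<open>C q ^ J\<close> per outer step (\<open>bregman_perturbation\<close>).

  Summation over \<open>K\<close> outer steps yields some \<open>k < K\<close> with
  \<open>\<parallel>s\<^sub>k\<parallel>\<^sup>2 \<le> D\<^sub>0 / (\<delta> K) + C q ^ J / \<delta>\<close>, where \<open>D\<^sub>0\<close> is the initial Bregman distance.
  Both terms are at most \<open>\<epsilon>/2\<close> once \<open>K\<close> is of order \<open>1/\<epsilon>\<close> and \<open>J\<close> of order
  \<open>ln (1/\<epsilon>)\<close>, and \<open>k\<close> outer steps use \<open>k (2 + J)\<close> gradients.
\<close>

section \<open>Convex functions, subdifferentials and proximal maps\<close>

lemma closed_proper_convex_not_MInf:
  "closed_proper_convex f \<Longrightarrow> f x \<noteq> -\<infinity>"
  by (auto simp: closed_proper_convex_def)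

lemma closed_proper_convex_finite_point:
  assumes "closed_proper_convex f"
  obtains x r where "f x = ereal r"
proof -
  obtain x where "f x < \<infinity>"
    using assms by (auto simp: closed_proper_convex_def dom_fun_def)
  then show ?thesis
    using that closed_proper_convex_not_MInf[OF assms, of x] by (cases "f x") auto
qed

lemma subdifferential_finite:
  assumes f: "closed_proper_convex f" and s: "s \<in> subdifferential f x"
  obtains r where "f x = ereal r"
proof -
  obtain y b where "f y = ereal b"
    by (rule closed_proper_convex_finite_point[OF f])
  then have "f x + ereal (s \<bullet> (y - x)) \<le> ereal b"
    using s by (metis (mono_tags, lifting) mem_Collect_eq subdifferential_def)
  then show ?thesis
    using that closed_proper_convex_not_MInf[OF f, of x] by (cases "f x") auto
qed

lemma subdifferential_subset_dom:
  "closed_proper_convex f \<Longrightarrow> s \<in> subdifferential f x \<Longrightarrow> x \<in> dom_fun f"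
  by (auto elim!: subdifferential_finite simp: dom_fun_def)

lemma subdifferential_monotone:
  assumes f: "closed_proper_convex f"
    and s: "s \<in> subdifferential f x" and t: "t \<in> subdifferential f y"
  shows "(s - t) \<bullet> (x - y) \<ge> 0"
proof -
  obtain a b where ab: "f x = ereal a" "f y = ereal b"
    using subdifferential_finite[OF f] s t by metis
  have "f x + ereal (s \<bullet> (y - x)) \<le> f y" "f y + ereal (t \<bullet> (x - y)) \<le> f x"
    using s t by (auto simp: subdifferential_def)
  then have "a + s \<bullet> (y - x) \<le> b" "b + t \<bullet> (x - y) \<le> a"
    by (auto simp: ab)
  then show ?thesis
    by (simp add: inner_diff_left inner_diff_right)
qed

lemma closed_subdifferential:
  assumes f: "closed_proper_convex f"
  shows "closed (subdifferential f x)"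
proof (cases "\<exists>r. f x = ereal r")
  case True
  then obtain r where r: "f x = ereal r" ..
  have "subdifferential f x = (\<Inter>y. {s. f x + ereal (s \<bullet> (y - x)) \<le> f y})"
    by (auto simp: subdifferential_def)
  moreover have "closed {s. f x + ereal (s \<bullet> (y - x)) \<le> f y}" for y
  proof (cases "f y")
    case (real b)
    have "{s. f x + ereal (s \<bullet> (y - x)) \<le> f y} = {s. r + s \<bullet> (y - x) \<le> b}"
      by (auto simp: r real)
    also have "closed \<dots>"
      by (intro closed_Collect_le continuous_intros)
    finally show ?thesis .
  qed (use closed_proper_convex_not_MInf[OF f] in auto)
  ultimately show ?thesis
    by (auto intro!: closed_INT)
next
  case False
  then have "subdifferential f x = {}"
    using subdifferential_finite[OF f] by blast
  then show ?thesis by simp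
qed

lemma subdifferential_scale:
  assumes f: "closed_proper_convex f" and c: "c > 0"
  shows "s \<in> subdifferential (\<lambda>y. ereal c * f y) x \<longleftrightarrow> (1 / c) *\<^sub>R s \<in> subdifferential f x"
proof -
  have "ereal c * f x + ereal (s \<bullet> (y - x)) \<le> ereal c * f y
    \<longleftrightarrow> f x + ereal (((1 / c) *\<^sub>R s) \<bullet> (y - x)) \<le> f y" for y
    using c closed_proper_convex_not_MInf[OF f, of x] closed_proper_convex_not_MInf[OF f, of y]
    by (cases "f x"; cases "f y") (auto simp: field_simps)
  then show ?thesis
    by (simp add: subdifferential_def)
qed

text \<open>Strong monotonicity of \<open>(1/c) I + \<partial>f\<close> makes the solution of the inclusion unique and its
  dependence on the centre \<open>z\<close> nonexpansive.\<close>

lemma prox_inclusion_nonexpansive: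
  assumes f: "closed_proper_convex f" and c: "c > 0"
    and p: "(1 / c) *\<^sub>R (z - p) \<in> subdifferential f p"
    and q: "(1 / c) *\<^sub>R (w - q) \<in> subdifferential f q"
  shows "norm (p - q) \<le> norm (z - w)"
proof -
  have "0 \<le> ((1 / c) *\<^sub>R (z - p) - (1 / c) *\<^sub>R (w - q)) \<bullet> (p - q)"
    by (rule subdifferential_monotone[OF f p q])
  also have "\<dots> = (1 / c) * ((z - w) \<bullet> (p - q) - (p - q) \<bullet> (p - q))"
    by (simp add: algebra_simps inner_diff_left inner_diff_right)
  finally have "(p - q) \<bullet> (p - q) \<le> (z - w) \<bullet> (p - q)"
    using c by (simp add: zero_le_mult_iff zero_le_divide_iff)
  also have "\<dots> \<le> norm (z - w) * norm (p - q)"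
    by (rule norm_cauchy_schwarz)
  finally have "norm (p - q) * norm (p - q) \<le> norm (z - w) * norm (p - q)"
    by (simp add: dot_square_norm power2_eq_square)
  then show ?thesis
    by (cases "norm (p - q) = 0") auto
qed

lemma prox_eqI:
  assumes f: "closed_proper_convex f" and c: "c > 0"
    and p: "(1 / c) *\<^sub>R (z - p) \<in> subdifferential f p"
  shows "prox (\<lambda>y. ereal c * f y) z = p"
proof -
  have char: "z \<in> {q + s |s. s \<in> subdifferential (\<lambda>y. ereal c * f y) q}
    \<longleftrightarrow> (1 / c) *\<^sub>R (z - q) \<in> subdifferential f q" for q
    unfolding subdifferential_scale[OF f c] by (auto simp: algebra_simps) (metis add_diff_cancel_left' diff_add_cancel add.commute scaleR_diff_right)
  show ?thesis
    unfolding prox_def char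
  proof (rule the_equality)
    show "q = p" if "(1 / c) *\<^sub>R (z - q) \<in> subdifferential f q" for q
      using prox_inclusion_nonexpansive[OF f c that p] by simp
  qed (fact p)
qed

text \<open>A bounded domain gives existence by compactness: the sublevel sets of \<open>f + q\<close> are closed
  because the epigraph is closed, and bounded because they lie in the domain, so a decreasing
  sequence of nonempty ones has a common point. This first bounds \<open>f + q\<close> from below (a common
  point of all sublevel sets would have value \<open>-\<infinity>\<close>), and then yields a point at the infimum.\<close>

lemma exists_minimizer_perturbed:
  fixes f :: "'a::euclidean_space \<Rightarrow> ereal" and q :: "'a \<Rightarrow> real"
  assumes f: "closed_proper_convex f" and bdd: "bounded (dom_fun f)"
    and q: "continuous_on UNIV q"
  obtains p a where "f p = ereal a" "\<And>y b. f y = ereal b \<Longrightarrow> a + q p \<le> b + q y"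
proof -
  define S where "S r = {y. f y \<le> ereal (r - q y)}" for r
  have S_mono: "S r \<subseteq> S r'" if "r \<le> r'" for r r'
    using that by (auto simp: S_def intro: order_trans)
  have compact_S: "compact (S r)" for r
  proof -
    have "S r = (\<lambda>y. (y, r - q y)) -` epi f"
      by (auto simp: S_def epi_def)
    moreover have "closed \<dots>"
      using f q by (intro closed_vimage continuous_intros) (auto simp: closed_proper_convex_def)
    ultimately have "closed (S r)" by simp
    moreover have "S r \<subseteq> dom_fun f"
      by (auto simp: S_def dom_fun_def)
    ultimately show ?thesis
      using bdd bounded_subset compact_eq_bounded_closed by blast
  qed
  have common_point: "\<exists>y. \<forall>n. y \<in> S (t n)" if "\<And>n. S (t n) \<noteq> {}" "decseq t" for t :: "nat \<Rightarrow> real"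
  proof -
    have "\<Inter>(range (\<lambda>n. S (t n))) \<noteq> {}"
      using that by (intro compact_nest compact_S S_mono) (auto simp: decseq_def)
    then show ?thesis by auto
  qed
  define V where "V = {r. S r \<noteq> {}}"
  obtain y0 b0 where y0: "f y0 = ereal b0"
    by (rule closed_proper_convex_finite_point[OF f])
  have V_I: "b + q y \<in> V" if "f y = ereal b" for y b
    using that by (auto simp: V_def S_def intro!: exI[of _ y])
  have bdd_V: "bdd_below V"
  proof (rule ccontr)
    assume not_bdd: "\<not> bdd_below V"
    have "S (- real n) \<noteq> {}" for n
    proof -
      obtain r where "r \<in> V" "r < - real n"
        using not_bdd by (auto simp: bdd_below_def not_le)
      then show ?thesis
        using S_mono[of r "- real n"] by (auto simp: V_def)
    qed
    then obtain y where y: "\<And>n. y \<in> S (- real n)"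
      using common_point[of "\<lambda>n. - real n"] by (auto simp: decseq_def)
    have "f y \<le> ereal (- real 0 - q y)"
      using y[of 0] by (simp add: S_def)
    then obtain b where b: "f y = ereal b"
      using closed_proper_convex_not_MInf[OF f, of y] by (cases "f y") auto
    obtain n where "real n > - q y - b"
      using reals_Archimedean2 by blast
    with y[of n] show False
      by (simp add: S_def b)
  qed
  define m where "m = Inf V"
  have "V \<noteq> {}" using V_I[OF y0] by auto
  have "S (m + 1 / real (Suc n)) \<noteq> {}" for n
  proof -
    obtain r where "r \<in> V" "r < m + 1 / real (Suc n)"
      using cInf_less_iff[OF \<open>V \<noteq> {}\<close> bdd_V] by (metis m_def less_add_same_cancel1 of_nat_0_less_iff zero_less_Suc zero_less_divide_1_iff)
    then show ?thesis
      using S_mono[of r "m + 1 / real (Suc n)"] by (auto simp: V_def)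
  qed
  then obtain p where p: "\<And>n. p \<in> S (m + 1 / real (Suc n))"
    using common_point[of "\<lambda>n. m + 1 / real (Suc n)"] by (auto simp: decseq_def frac_le)
  have "f p \<le> ereal (m + 1 / real (Suc 0) - q p)"
    using p[of 0] by (simp add: S_def)
  then obtain a where a: "f p = ereal a"
    using closed_proper_convex_not_MInf[OF f, of p] by (cases "f p") auto
  have "a + q p \<le> m"
  proof (rule field_le_epsilon)
    fix e :: real assume "e > 0"
    then obtain n where "1 / real (Suc n) < e"
      using nat_approx_posE by blast
    with p[of n] show "a + q p \<le> m + e"
      by (simp add: S_def a)
  qed
  moreover have "m \<le> b + q y" if "f y = ereal b" for y b
    unfolding m_def using V_I[OF that] bdd_V by (rule cInf_lower)
  ultimately show ?thesis
    using that[OF a] by fastforce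
qed

lemma epi_convexD:
  assumes f: "closed_proper_convex f" and "f x = ereal a" "f y = ereal b" "0 \<le> t" "t \<le> 1"
  shows "f (x + t *\<^sub>R (y - x)) \<le> ereal (a + t * (b - a))"
proof -
  have "convex (epi f)" "(x, a) \<in> epi f" "(y, b) \<in> epi f"
    using assms by (auto simp: closed_proper_convex_def epi_def)
  then have "(1 - t) *\<^sub>R (x, a) + t *\<^sub>R (y, b) \<in> epi f"
    using assms by (intro convexD) auto
  then show ?thesis
    by (simp add: epi_def algebra_simps)
qed

text \<open>Minty's theorem for subdifferentials with bounded domain: a minimizer \<open>p\<close> of
  \<open>f + \<parallel>\<cdot> - z\<parallel>\<^sup>2 / (2c)\<close> solves the inclusion, by comparing \<open>p\<close> with \<open>p + t (y - p)\<close>, dividing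
  by \<open>t\<close> and letting \<open>t\<close> tend to \<open>0\<close>.\<close>

lemma exists_prox:
  fixes f :: "'a::euclidean_space \<Rightarrow> ereal"
  assumes f: "closed_proper_convex f" and bdd: "bounded (dom_fun f)" and c: "c > 0"
  shows "\<exists>p. (1 / c) *\<^sub>R (z - p) \<in> subdifferential f p"
proof -
  define q where "q y = (1 / (2 * c)) * (norm (y - z))\<^sup>2" for y
  have "continuous_on UNIV q"
    unfolding q_def by (intro continuous_intros)
  then obtain p a where a: "f p = ereal a"
    and min: "\<And>y b. f y = ereal b \<Longrightarrow> a + q p \<le> b + q y"
    using exists_minimizer_perturbed[OF f bdd] by metis
  have "a + ((1 / c) *\<^sub>R (z - p)) \<bullet> (y - p) \<le> b" if b: "f y = ereal b" for y b
  proof -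
    define A where "A = a + ((1 / c) *\<^sub>R (z - p)) \<bullet> (y - p) - b"
    define B where "B = (1 / (2 * c)) * (norm (y - p))\<^sup>2"
    have small: "A \<le> t * B" if t: "0 < t" "t \<le> 1" for t
    proof -
      let ?y = "p + t *\<^sub>R (y - p)"
      have "f ?y \<le> ereal (a + t * (b - a))"
        using t by (intro epi_convexD f a b) auto
      moreover from this obtain b' where b': "f ?y = ereal b'"
        using closed_proper_convex_not_MInf[OF f, of ?y] by (cases "f ?y") auto
      ultimately have "a + q p \<le> a + t * (b - a) + q ?y"
        using min[OF b'] by simp
      moreover have "q ?y = q p - t * (((1 / c) *\<^sub>R (z - p)) \<bullet> (y - p)) + t * (t * B)"
      proof -
        have "(norm (?y - z))\<^sup>2 = (norm ((p - z) + t *\<^sub>R (y - p)))\<^sup>2"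
          by (simp add: algebra_simps)
        also have "\<dots> = (norm (p - z))\<^sup>2 - 2 * t * ((z - p) \<bullet> (y - p)) + t * (t * (norm (y - p))\<^sup>2)"
          unfolding power2_norm_eq_inner
          by (simp add: inner_add_left inner_add_right inner_diff_left inner_diff_right inner_commute algebra_simps)
        finally have "(norm (?y - z))\<^sup>2 = \<dots>" .
        then show ?thesis
          using c unfolding q_def B_def inner_scaleR_left by (simp only:) (simp add: field_simps)
      qed
      ultimately have "t * A \<le> t * (t * B)"
        by (simp add: A_def algebra_simps)
      then show ?thesis
        using t by simp
    qed
    have "((\<lambda>t. t * B) \<longlongrightarrow> 0 * B) (at_right 0)"
      by (intro tendsto_intros)
    moreover have "\<forall>\<^sub>F t in at_right 0. A \<le> t * B"
      unfolding eventually_at_right_field using small by (intro exI[of _ 1]) auto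
    ultimately have "A \<le> 0 * B"
      by (intro tendsto_lowerbound) auto
    then show ?thesis
      by (simp add: A_def)
  qed
  then have "f p + ereal (((1 / c) *\<^sub>R (z - p)) \<bullet> (y - p)) \<le> f y" for y
    using closed_proper_convex_not_MInf[OF f, of y] a by (cases "f y") auto
  then show ?thesis
    unfolding subdifferential_def by auto
qed

lemma prox_inclusion:
  assumes f: "closed_proper_convex f" and "bounded (dom_fun f)" and c: "c > 0"
  shows "(1 / c) *\<^sub>R (z - prox (\<lambda>y. ereal c * f y) z) \<in> subdifferential f (prox (\<lambda>y. ereal c * f y) z)"
  using exists_prox[OF assms, of z] prox_eqI[OF f c] by metis

section \<open>Gradients, the descent lemma and Bregman distances\<close>

lemma GDERIV_unique:
  fixes F :: "'a::euclidean_space \<Rightarrow> real"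
  assumes "GDERIV F x :> a" "GDERIV F x :> b"
  shows "a = b"
proof -
  have "(\<lambda>h. h \<bullet> a) = (\<lambda>h. h \<bullet> b)"
    using assms unfolding gderiv_def by (rule has_derivative_unique)
  then show ?thesis
    by (metis vector_eq_ldot)
qed

lemma gradient_eqI:
  fixes F :: "'a::euclidean_space \<Rightarrow> real"
  shows "GDERIV F x :> D \<Longrightarrow> gradient F x = D"
  unfolding gradient_def by (rule the_equality) (auto intro: GDERIV_unique)

lemma GDERIV_gradient:
  fixes F :: "'a::euclidean_space \<Rightarrow> real"
  assumes "F differentiable (at x)"
  shows "GDERIV F x :> gradient F x"
proof -
  obtain F' where F': "(F has_derivative F') (at x)"
    using assms by (auto simp: differentiable_def)
  \<comment> \<open>the Riesz representative of the derivative\<close>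
  have "F' = (\<lambda>h. h \<bullet> adjoint F' 1)"
    using adjoint_works[OF has_derivative_linear[OF F'], of _ 1] by auto
  then have "GDERIV F x :> adjoint F' 1"
    using F' by (simp add: gderiv_def)
  then show ?thesis
    using gradient_eqI by metis
qed

lemma grad_u_eq_fst_gradient:
  fixes \<phi> :: "'u::euclidean_space \<times> 'v::euclidean_space \<Rightarrow> real"
  assumes "\<phi> differentiable (at x)"
  shows "grad_u \<phi> x = fst (gradient \<phi> x)"
  unfolding grad_u_def
proof (rule gradient_eqI)
  have "(\<phi> has_derivative (\<lambda>h. h \<bullet> gradient \<phi> x)) (at (fst x, snd x))"
    using GDERIV_gradient[OF assms] by (simp add: gderiv_def)
  moreover have "((\<lambda>u. (u, snd x)) has_derivative (\<lambda>h. (h, 0))) (at (fst x))"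
    by (intro has_derivative_Pair has_derivative_ident has_derivative_const)
  ultimately have "((\<lambda>u. \<phi> (u, snd x)) has_derivative (\<lambda>h. (h, 0) \<bullet> gradient \<phi> x)) (at (fst x))"
    using has_derivative_compose[of "\<lambda>u. (u, snd x)" "\<lambda>h. (h, 0)" "fst x" UNIV \<phi>] by simp
  then show "GDERIV (\<lambda>u. \<phi> (u, snd x)) (fst x) :> fst (gradient \<phi> x)"
    by (simp add: gderiv_def inner_prod_def)
qed

lemma grad_v_eq_snd_gradient:
  fixes \<phi> :: "'u::euclidean_space \<times> 'v::euclidean_space \<Rightarrow> real"
  assumes "\<phi> differentiable (at x)"
  shows "grad_v \<phi> x = snd (gradient \<phi> x)"
  unfolding grad_v_def
proof (rule gradient_eqI)
  have "(\<phi> has_derivative (\<lambda>h. h \<bullet> gradient \<phi> x)) (at (fst x, snd x))"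
    using GDERIV_gradient[OF assms] by (simp add: gderiv_def)
  moreover have "((\<lambda>v. (fst x, v)) has_derivative (\<lambda>h. (0, h))) (at (snd x))"
    by (intro has_derivative_Pair has_derivative_ident has_derivative_const)
  ultimately have "((\<lambda>v. \<phi> (fst x, v)) has_derivative (\<lambda>h. (0, h) \<bullet> gradient \<phi> x)) (at (snd x))"
    using has_derivative_compose[of "\<lambda>v. (fst x, v)" "\<lambda>h. (0, h)" "snd x" UNIV \<phi>] by simp
  then show "GDERIV (\<lambda>v. \<phi> (fst x, v)) (snd x) :> snd (gradient \<phi> x)"
    by (simp add: gderiv_def inner_prod_def)
qed

text \<open>The first argument is the far point, the second the point of linearization. For
  the coupling \<open>\<phi>\<close> the value can be negative; it is a distance for the kernel \<open>h\<close> below.\<close>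

definition bregman :: "('a::euclidean_space \<Rightarrow> real) \<Rightarrow> 'a \<Rightarrow> 'a \<Rightarrow> real" where
  "bregman h y x = h y - h x - (y - x) \<bullet> gradient h x"

lemma bregman_three_point:
  "bregman h z y = bregman h z x - bregman h y x - (y - z) \<bullet> (gradient h x - gradient h y)"
  by (simp add: bregman_def inner_diff_left inner_diff_right)

lemma bregman_uminus:
  assumes "h differentiable (at x)"
  shows "bregman (\<lambda>z. - h z) y x = - bregman h y x"
  using gradient_eqI[OF GDERIV_minus[OF GDERIV_gradient[OF assms]]]
  by (simp add: bregman_def)

text \<open>Along the segment from \<open>x\<close> to \<open>y\<close>, the function minus its claimed upper bound is
  nonincreasing, as the Lipschitz condition makes its derivative nonpositive.\<close>

lemma descent_lemma:
  fixes F :: "'a::euclidean_space \<Rightarrow> real"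
  assumes diff: "\<And>x. F differentiable (at x)" and lip: "L-lipschitz_on UNIV (gradient F)"
  shows "bregman F y x \<le> L / 2 * (norm (y - x))\<^sup>2"
proof -
  define d where "d = y - x"
  define p where "p t = F (x + t *\<^sub>R d) - t * (d \<bullet> gradient F x) - L / 2 * (norm d)\<^sup>2 * t\<^sup>2" for t
  have "p 1 \<le> p 0"
  proof (rule DERIV_nonpos_imp_nonincreasing[of 0 1 p])
    fix t :: real assume t: "0 \<le> t" "t \<le> 1"
    let ?z = "x + t *\<^sub>R d"
    have F: "(F has_derivative (\<lambda>h. h \<bullet> gradient F ?z)) (at ?z)"
      using GDERIV_gradient[OF diff] by (simp add: gderiv_def)
    have line: "((\<lambda>t. x + t *\<^sub>R d) has_derivative (\<lambda>h. h *\<^sub>R d)) (at t)"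
      by (auto intro!: derivative_eq_intros)
    have "((\<lambda>t. F (x + t *\<^sub>R d)) has_derivative (\<lambda>h. (h *\<^sub>R d) \<bullet> gradient F ?z)) (at t)"
      by (rule has_derivative_compose[OF line F])
    then have "DERIV (\<lambda>t. F (x + t *\<^sub>R d)) t :> d \<bullet> gradient F ?z"
      by (simp add: has_field_derivative_def mult.commute[of _ "d \<bullet> gradient F ?z"])
    then have "DERIV p t :> d \<bullet> gradient F ?z - d \<bullet> gradient F x - L / 2 * (norm d)\<^sup>2 * (2 * t)"
      unfolding p_def by (auto intro!: derivative_eq_intros)
    moreover have "d \<bullet> gradient F ?z - d \<bullet> gradient F x \<le> L * (norm d)\<^sup>2 * t"
    proof -
      have "norm (gradient F ?z - gradient F x) \<le> L * (t * norm d)"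
        using lipschitz_on_normD[OF lip, of ?z x] t by simp
      then have "norm d * norm (gradient F ?z - gradient F x) \<le> norm d * (L * (t * norm d))"
        by (rule mult_left_mono) simp
      with norm_cauchy_schwarz[of d "gradient F ?z - gradient F x"] show ?thesis
        by (simp add: inner_diff_right power2_eq_square algebra_simps)
    qed
    ultimately show "\<exists>D. DERIV p t :> D \<and> D \<le> 0"
      by (intro exI conjI) auto
  qed simp
  then show ?thesis
    by (simp add: p_def bregman_def d_def algebra_simps)
qed

lemma descent_lemma_lower:
  fixes F :: "'a::euclidean_space \<Rightarrow> real"
  assumes diff: "\<And>x. F differentiable (at x)" and lip: "L-lipschitz_on UNIV (gradient F)"
  shows "bregman F y x \<ge> - (L / 2 * (norm (y - x))\<^sup>2)"
proof -
  have "gradient (\<lambda>z. - F z) = (\<lambda>z. - gradient F z)"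
    by (intro ext gradient_eqI GDERIV_minus GDERIV_gradient diff)
  then have "L-lipschitz_on UNIV (gradient (\<lambda>z. - F z))"
    using lip by simp
  then show ?thesis
    using descent_lemma[of "\<lambda>z. - F z" L y x] diff bregman_uminus[OF diff]
    by (auto intro: differentiable_minus)
qed

text \<open>Cocoercivity of the gradient in Bregman form. The function \<open>bregman h \<cdot> x\<close> is nonnegative,
  and one gradient step of length \<open>1/\<beta>\<close> from \<open>y\<close> lowers it by at least the right-hand side.\<close>

lemma bregman_ge_gradient_diff:
  fixes h :: "'a::euclidean_space \<Rightarrow> real"
  assumes nonneg: "\<And>y x. bregman h y x \<ge> 0"
    and smooth: "\<And>y x. bregman h y x \<le> \<beta> / 2 * (norm (y - x))\<^sup>2" and \<beta>: "\<beta> > 0"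
  shows "bregman h y x \<ge> (norm (gradient h x - gradient h y))\<^sup>2 / (2 * \<beta>)"
proof -
  define d where "d = gradient h x - gradient h y"
  define z where "z = y + (1 / \<beta>) *\<^sub>R d"
  have "0 \<le> bregman h z x"
    by (rule nonneg)
  also have "\<dots> = bregman h z y + bregman h y x - (z - y) \<bullet> d"
    by (simp add: bregman_def d_def inner_diff_left inner_diff_right)
  also have "bregman h z y \<le> \<beta> / 2 * (norm (z - y))\<^sup>2"
    by (rule smooth)
  also have "\<beta> / 2 * (norm (z - y))\<^sup>2 = (norm d)\<^sup>2 / (2 * \<beta>)"
    using \<beta> by (simp add: z_def power2_eq_square)
  also have "(z - y) \<bullet> d = 2 * ((norm d)\<^sup>2 / (2 * \<beta>))"
    using \<beta> by (simp add: z_def power2_norm_eq_inner)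
  finally show ?thesis
    by (simp add: d_def)
qed

section \<open>The outer map and its approximation by the inner loop\<close>

lemma norm_snd_le_norm: "norm (snd z) \<le> norm (z :: 'a::real_normed_vector \<times> 'b::real_normed_vector)"
  by (metis norm_snd_le prod.collapse)

lemma closed_saddle_op:
  assumes "closed_proper_convex f" "closed_proper_convex g"
  shows "closed (saddle_op f g \<phi> x)"
proof -
  have "saddle_op f g \<phi> x = (\<lambda>z. (grad_u \<phi> x, - grad_v \<phi> x) + z) `
      (subdifferential f (fst x) \<times> subdifferential g (snd x))"
    by (auto simp: saddle_op_def image_iff)
  then show ?thesis
    using assms by (simp only:) (intro closed_translation closed_Times closed_subdifferential)
qed

text \<open>Closedness makes the minimum in the definition of stationarity attained, so that any one
  small element of \<open>M (R x)\<close> suffices.\<close>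

lemma eps_stationaryI:
  fixes M :: "'a::euclidean_space \<Rightarrow> 'a set"
  assumes "closed (M (R x))" and s: "s \<in> M (R x)" "(norm s)\<^sup>2 \<le> \<epsilon>"
  shows "eps_stationary M R \<epsilon> x"
proof -
  obtain t where t: "t \<in> M (R x)" "\<And>y. y \<in> M (R x) \<Longrightarrow> norm t \<le> norm y"
    using distance_attains_inf[of "M (R x)" 0] assms by auto
  then have "is_arg_min (\<lambda>s. (norm s)\<^sup>2) (\<lambda>s. s \<in> M (R x)) t"
    by (auto simp: is_arg_min_linorder intro: power_mono)
  moreover have "(norm t)\<^sup>2 \<le> \<epsilon>"
    using power_mono[OF t(2)[OF s(1)], of 2] s(2) by (meson norm_ge_zero order_trans)
  ultimately show ?thesis
    unfolding eps_stationary_def by blast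
qed

locale composite_saddle =
  fixes f :: "'u::euclidean_space \<Rightarrow> ereal"
    and g :: "'v::euclidean_space \<Rightarrow> ereal"
    and \<phi> :: "'u \<times> 'v \<Rightarrow> real"
    and Luu Luv Lvu Lvv L \<Omega> \<tau> :: real
  assumes smooth: "composite_smooth f g \<phi> Luu Luv Lvu Lvv"
    and L_pos: "L > 0" and lipschitz_grad: "L-lipschitz_on UNIV (gradient \<phi>)"
    and bounded_dom: "bounded_domain f g \<Omega>"
    and \<tau>_pos: "\<tau> > 0" and \<tau>_upper: "\<tau> < 1 / (L + max Luu Lvv)"
begin

abbreviation "h \<equiv> resolvent_kernel \<tau> \<phi>"
abbreviation "M \<equiv> saddle_op f g \<phi>"
abbreviation "R \<equiv> resolvent h M"

definition "\<eta> = \<tau> / (1 + 2 * Lvv * \<tau>)"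

text \<open>Smoothness constant of the kernel \<open>h\<close>, that is, a Lipschitz constant of its gradient.\<close>

definition "\<beta> = 1 / \<tau> + L"

text \<open>Contraction factor of the inner map. Both \<open>L\<close> and \<open>Lvv\<close> are Lipschitz constants of
  \<open>v \<mapsto> \<nabla>\<^sub>v \<phi>(u, v)\<close>, and neither need dominate the other, so the smaller one is
  taken: then \<open>2 min L Lvv \<le> L + Lvv < 1/\<tau>\<close>.\<close>

definition "q = (2 * Lvv + 2 * min L Lvv) / (1 / \<tau> + 2 * Lvv)"

definition "u_step x = prox (\<lambda>y. ereal \<tau> * f y) (fst x - \<tau> *\<^sub>R grad_u \<phi> x)"

definition "v_map x w = prox (\<lambda>y. ereal \<eta> * g y)
  ((\<eta> / \<tau>) *\<^sub>R (snd x - \<tau> *\<^sub>R grad_v \<phi> x) + (2 * \<eta> * Lvv) *\<^sub>R (w + (1 / Lvv) *\<^sub>R grad_v \<phi> (u_step x, w)))"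

lemma f_cpc: "closed_proper_convex f" and g_cpc: "closed_proper_convex g"
  and \<phi>_diff: "\<phi> differentiable (at x)" and Lvv_pos: "Lvv > 0"
  using smooth unfolding composite_smooth_def by blast+

lemma \<beta>_pos: "\<beta> > 0"
  using \<tau>_pos L_pos by (simp add: \<beta>_def add_pos_pos)

lemma step_size_bound: "L + Lvv < 1 / \<tau>"
proof -
  have "\<tau> * (L + max Luu Lvv) < 1"
    using \<tau>_upper L_pos Lvv_pos by (simp add: pos_less_divide_eq)
  moreover have "\<tau> * (L + Lvv) \<le> \<tau> * (L + max Luu Lvv)"
    using \<tau>_pos by simp
  ultimately have "\<tau> * (L + Lvv) < 1"
    by linarith
  then show ?thesis
    using \<tau>_pos by (simp add: pos_less_divide_eq mult.commute)
qed

lemma \<eta>_pos: "\<eta> > 0" and inverse_\<eta>: "1 / \<eta> = 1 / \<tau> + 2 * Lvv"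
  using \<tau>_pos Lvv_pos by (auto simp: \<eta>_def field_simps intro!: divide_pos_pos add_pos_pos)

lemma q_pos: "0 < q" and q_less_1: "q < 1"
proof -
  have "0 < 1 / \<tau> + 2 * Lvv"
    using \<tau>_pos Lvv_pos by (simp add: add_pos_pos)
  moreover have "2 * min L Lvv < 1 / \<tau>"
    using step_size_bound by linarith
  ultimately show "0 < q" "q < 1"
    using L_pos Lvv_pos by (auto simp: q_def)
qed

lemma bounded_dom_f: "bounded (dom_fun f)" and bounded_dom_g: "bounded (dom_fun g)"
proof -
  obtain u v where u: "u \<in> dom_fun f" and v: "v \<in> dom_fun g"
    using f_cpc g_cpc by (auto simp: closed_proper_convex_def)
  have bdd: "norm (x - y) \<le> \<Omega>" if "x \<in> dom_fun f \<times> dom_fun g" "y \<in> dom_fun f \<times> dom_fun g" for x y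
    using bounded_dom that unfolding bounded_domain_def by blast
  have "dist u u' \<le> \<Omega>" if "u' \<in> dom_fun f" for u'
    using bdd[of "(u, v)" "(u', v)"] u v that by (simp add: dist_norm)
  then show "bounded (dom_fun f)"
    unfolding bounded_def by blast
  have "dist v v' \<le> \<Omega>" if "v' \<in> dom_fun g" for v'
    using bdd[of "(u, v)" "(u, v')"] u v that by (simp add: dist_norm)
  then show "bounded (dom_fun g)"
    unfolding bounded_def by blast
qed

lemma resolvent_kernel_eq: "h = (\<lambda>x. 1 / (2 * \<tau>) * (x \<bullet> x) - \<phi> x)"
  by (auto simp: resolvent_kernel_def inner_prod_def power2_norm_eq_inner)

lemma GDERIV_resolvent_kernel: "GDERIV h x :> (1 / \<tau>) *\<^sub>R x - gradient \<phi> x"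
proof -
  have "(\<phi> has_derivative (\<lambda>h. h \<bullet> gradient \<phi> x)) (at x)"
    using GDERIV_gradient[OF \<phi>_diff] by (simp add: gderiv_def)
  then show ?thesis
    unfolding resolvent_kernel_eq gderiv_def using \<tau>_pos
    by (auto intro!: derivative_eq_intros simp: inner_diff_right inner_commute fun_eq_iff field_simps)
qed

lemma gradient_resolvent_kernel: "gradient h x = (1 / \<tau>) *\<^sub>R x - gradient \<phi> x"
  by (rule gradient_eqI[OF GDERIV_resolvent_kernel])

lemma bregman_resolvent_kernel:
  "bregman h y x = 1 / (2 * \<tau>) * (norm (y - x))\<^sup>2 - bregman \<phi> y x"
  using \<tau>_pos unfolding bregman_def gradient_resolvent_kernel
  by (simp add: resolvent_kernel_eq power2_norm_eq_inner inner_diff_left inner_diff_right inner_commute field_simps)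

text \<open>As \<open>1/\<tau> > L\<close>, the quadratic part of \<open>h\<close> outweighs the possibly nonconvex \<open>-\<phi>\<close>.\<close>

lemma bregman_nonneg: "bregman h y x \<ge> 0"
proof -
  have "L * (norm (y - x))\<^sup>2 \<le> (1 / \<tau>) * (norm (y - x))\<^sup>2"
    using step_size_bound Lvv_pos by (intro mult_right_mono) auto
  moreover have "bregman \<phi> y x \<le> L / 2 * (norm (y - x))\<^sup>2"
    by (rule descent_lemma[OF \<phi>_diff lipschitz_grad])
  ultimately show ?thesis
    by (simp add: bregman_resolvent_kernel)
qed

lemma bregman_le: "bregman h y x \<le> \<beta> / 2 * (norm (y - x))\<^sup>2"
  using descent_lemma_lower[OF \<phi>_diff lipschitz_grad, where x = x and y = y]
  by (simp add: bregman_resolvent_kernel \<beta>_def algebra_simps)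

lemma gradient_resolvent_kernel_lipschitz:
  "norm (gradient h x - gradient h y) \<le> \<beta> * norm (x - y)"
proof -
  have "gradient h x - gradient h y = (1 / \<tau>) *\<^sub>R (x - y) - (gradient \<phi> x - gradient \<phi> y)"
    by (simp add: gradient_resolvent_kernel algebra_simps)
  then have "norm (gradient h x - gradient h y) \<le> norm ((1 / \<tau>) *\<^sub>R (x - y)) + norm (gradient \<phi> x - gradient \<phi> y)"
    by (simp only: norm_triangle_ineq4)
  also have "norm (gradient \<phi> x - gradient \<phi> y) \<le> L * norm (x - y)"
    by (rule lipschitz_on_normD[OF lipschitz_grad]) auto
  also have "norm ((1 / \<tau>) *\<^sub>R (x - y)) = (1 / \<tau>) * norm (x - y)"
    using \<tau>_pos by simp
  finally show ?thesis
    by (simp add: \<beta>_def algebra_simps)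
qed

lemma grad_v_lipschitz: "norm (grad_v \<phi> (u, v) - grad_v \<phi> (u, w)) \<le> min L Lvv * norm (v - w)"
proof -
  have "norm (grad_v \<phi> (u, v) - grad_v \<phi> (u, w)) \<le> norm (gradient \<phi> (u, v) - gradient \<phi> (u, w))"
    by (simp add: grad_v_eq_snd_gradient[OF \<phi>_diff] norm_snd_le_norm flip: snd_diff)
  also have "\<dots> \<le> L * norm ((u, v) - (u, w))"
    by (rule lipschitz_on_normD[OF lipschitz_grad]) auto
  finally have "norm (grad_v \<phi> (u, v) - grad_v \<phi> (u, w)) \<le> L * norm (v - w)"
    by simp
  moreover have "norm (grad_v \<phi> (u, v) - grad_v \<phi> (u, w)) \<le> Lvu * norm (u - u) + Lvv * norm (v - w)"
    using smooth unfolding composite_smooth_def by blast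
  ultimately show ?thesis
    by (simp add: min_def)
qed

text \<open>The proximal map is nonexpansive, and its argument depends on \<open>w\<close> through
  \<open>2 \<eta> (Lvv w + \<nabla>\<^sub>v \<phi>(u, w))\<close>. The factor \<open>q\<close> comes from the
  Lipschitz constants of these two terms, multiplied by \<open>\<eta>\<close>.\<close>

lemma v_map_contraction: "norm (v_map x w - v_map x w') \<le> q * norm (w - w')"
proof -
  let ?a = "\<lambda>w. (\<eta> / \<tau>) *\<^sub>R (snd x - \<tau> *\<^sub>R grad_v \<phi> x)
    + (2 * \<eta> * Lvv) *\<^sub>R (w + (1 / Lvv) *\<^sub>R grad_v \<phi> (u_step x, w))"
  let ?d = "grad_v \<phi> (u_step x, w) - grad_v \<phi> (u_step x, w')"
  have "norm (v_map x w - v_map x w') \<le> norm (?a w - ?a w')"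
    unfolding v_map_def
    by (rule prox_inclusion_nonexpansive[OF g_cpc \<eta>_pos];
        rule prox_inclusion[OF g_cpc bounded_dom_g \<eta>_pos])
  also have "?a w - ?a w' = (2 * \<eta> * Lvv) *\<^sub>R (w - w') + (2 * \<eta>) *\<^sub>R ?d"
    using Lvv_pos by (simp add: algebra_simps)
  also have "norm \<dots> \<le> norm ((2 * \<eta> * Lvv) *\<^sub>R (w - w')) + norm ((2 * \<eta>) *\<^sub>R ?d)"
    by (rule norm_triangle_ineq)
  also have "\<dots> = 2 * \<eta> * Lvv * norm (w - w') + 2 * \<eta> * norm ?d"
    using \<eta>_pos Lvv_pos by (simp add: abs_mult)
  also have "\<dots> \<le> 2 * \<eta> * Lvv * norm (w - w') + 2 * \<eta> * (min L Lvv * norm (w - w'))"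
    using grad_v_lipschitz \<eta>_pos by (intro add_left_mono mult_left_mono) auto
  also have "\<dots> = (2 * Lvv + 2 * min L Lvv) / (1 / \<eta>) * norm (w - w')"
    using \<eta>_pos by (simp add: algebra_simps)
  finally show ?thesis
    unfolding inverse_\<eta> q_def .
qed

text \<open>At a fixed point the damping term \<open>2 Lvv w\<close> stands on both sides of the inclusion and
  cancels, because \<open>1/\<eta> = 1/\<tau> + 2 Lvv\<close>.\<close>

lemma v_map_fixed_point_iff:
  "v_map x w = w \<longleftrightarrow>
    (1 / \<tau>) *\<^sub>R (snd x - w) - grad_v \<phi> x + 2 *\<^sub>R grad_v \<phi> (u_step x, w) \<in> subdifferential g w"
proof -
  let ?z = "(\<eta> / \<tau>) *\<^sub>R (snd x - \<tau> *\<^sub>R grad_v \<phi> x)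
    + (2 * \<eta> * Lvv) *\<^sub>R (w + (1 / Lvv) *\<^sub>R grad_v \<phi> (u_step x, w))"
  have "v_map x w = w \<longleftrightarrow> (1 / \<eta>) *\<^sub>R (?z - w) \<in> subdifferential g w"
    unfolding v_map_def using prox_inclusion[OF g_cpc bounded_dom_g \<eta>_pos] prox_eqI[OF g_cpc \<eta>_pos]
    by metis
  also have "(1 / \<eta>) *\<^sub>R (?z - w) = (1 / \<eta>) *\<^sub>R ?z - (1 / \<eta>) *\<^sub>R w"
    by (rule scaleR_diff_right)
  also have "\<dots> = (1 / \<eta>) *\<^sub>R ?z - (1 / \<tau> + 2 * Lvv) *\<^sub>R w"
    by (simp only: inverse_\<eta>)
  also have "\<dots> = (1 / \<tau>) *\<^sub>R (snd x - w) - grad_v \<phi> x + 2 *\<^sub>R grad_v \<phi> (u_step x, w)"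
    using \<eta>_pos \<tau>_pos Lvv_pos by (simp add: scaleR_add_right algebra_simps)
  finally show ?thesis .
qed

lemma u_step_eq_iff:
  "u_step x = u \<longleftrightarrow> (1 / \<tau>) *\<^sub>R (fst x - u) - grad_u \<phi> x \<in> subdifferential f u"
proof -
  have "u_step x = u \<longleftrightarrow> (1 / \<tau>) *\<^sub>R (fst x - \<tau> *\<^sub>R grad_u \<phi> x - u) \<in> subdifferential f u"
    unfolding u_step_def using prox_inclusion[OF f_cpc bounded_dom_f \<tau>_pos] prox_eqI[OF f_cpc \<tau>_pos]
    by metis
  also have "(1 / \<tau>) *\<^sub>R (fst x - \<tau> *\<^sub>R grad_u \<phi> x - u) = (1 / \<tau>) *\<^sub>R (fst x - u) - grad_u \<phi> x"
    using \<tau>_pos by (simp add: algebra_simps)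
  finally show ?thesis .
qed

text \<open>The coupling term in \<open>h\<close> cancels \<open>\<nabla>\<^sub>u \<phi>(y)\<close> in the first component of the
  inclusion, which therefore is an explicit proximal step; the second component remains implicit
  and is the fixed point equation of the inner map.\<close>

lemma resolvent_inclusion_iff:
  "gradient h x - gradient h y \<in> M y \<longleftrightarrow> fst y = u_step x \<and> v_map x (snd y) = snd y"
proof -
  have "gradient h x - gradient h y =
    (grad_u \<phi> y + ((1 / \<tau>) *\<^sub>R (fst x - fst y) - grad_u \<phi> x),
     - grad_v \<phi> y + ((1 / \<tau>) *\<^sub>R (snd x - snd y) - grad_v \<phi> x + 2 *\<^sub>R grad_v \<phi> y))"
    by (simp add: gradient_resolvent_kernel prod_eq_iff grad_u_eq_fst_gradient[OF \<phi>_diff]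
        grad_v_eq_snd_gradient[OF \<phi>_diff] algebra_simps scaleR_2)
  moreover have "(grad_u \<phi> y + s, - grad_v \<phi> y + t) \<in> M y
    \<longleftrightarrow> s \<in> subdifferential f (fst y) \<and> t \<in> subdifferential g (snd y)" for s t
    by (auto simp: saddle_op_def)
  ultimately have "gradient h x - gradient h y \<in> M y \<longleftrightarrow>
    u_step x = fst y \<and> (1 / \<tau>) *\<^sub>R (snd x - snd y) - grad_v \<phi> x + 2 *\<^sub>R grad_v \<phi> y \<in> subdifferential g (snd y)"
    by (simp only: u_step_eq_iff)
  then show ?thesis
    unfolding v_map_fixed_point_iff by (metis prod.collapse)
qed

lemma resolvent_exists_unique: "\<exists>!y. gradient h x - gradient h y \<in> M y"
proof -
  have "\<exists>!w. v_map x w = w"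
    using q_pos q_less_1 v_map_contraction
    by (intro banach_fix_type[of q]) (auto simp: dist_norm)
  then show ?thesis
    unfolding resolvent_inclusion_iff by (metis prod.collapse fst_conv snd_conv)
qed

lemma resolvent_inclusion: "gradient h x - gradient h (R x) \<in> M (R x)"
  unfolding resolvent_def by (rule theI'[OF resolvent_exists_unique])

lemma fst_resolvent: "fst (R x) = u_step x" and v_map_snd_resolvent: "v_map x (snd (R x)) = snd (R x)"
  using resolvent_inclusion[of x] by (auto simp: resolvent_inclusion_iff)

lemma saddle_op_in_dom: "w \<in> M x \<Longrightarrow> x \<in> dom_fun f \<times> dom_fun g"
  using subdifferential_subset_dom[OF f_cpc] subdifferential_subset_dom[OF g_cpc]
  by (auto simp: saddle_op_def mem_Times_iff)

lemma resolvent_in_dom: "R x \<in> dom_fun f \<times> dom_fun g"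
  using saddle_op_in_dom resolvent_inclusion by blast

lemma sa_mgda_inner_eq:
  "sa_mgda_inner g \<phi> \<tau> Lvv (u_step x) (snd x) (grad_v \<phi> x) j = ((v_map x ^^ j) (snd x), j)"
  by (induction j) (simp_all add: v_map_def \<eta>_def Let_def)

lemma sa_mgda_step_eq:
  "sa_mgda_step f g \<phi> \<tau> Lvv J x = ((u_step x, (v_map x ^^ J) (snd x)), 2 + J)"
proof -
  have "prox (\<lambda>y. ereal \<tau> * f y) (fst x - \<tau> *\<^sub>R grad_u \<phi> (fst x, snd x)) = u_step x"
    by (simp add: u_step_def)
  then show ?thesis
    using sa_mgda_inner_eq[of x J] by (simp add: sa_mgda_step_def Let_def case_prod_beta)
qed

lemma sa_mgda_iterate_0: "sa_mgda_iterate f g \<phi> \<tau> Lvv J x0 0 = x0"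
  by (simp add: sa_mgda_iterate_def)

lemma sa_mgda_iterate_Suc:
  "sa_mgda_iterate f g \<phi> \<tau> Lvv J x0 (Suc k) =
    (let x = sa_mgda_iterate f g \<phi> \<tau> Lvv J x0 k in (u_step x, (v_map x ^^ J) (snd x)))"
  by (simp add: sa_mgda_iterate_def Let_def case_prod_beta sa_mgda_step_eq)

lemma sa_mgda_gradients_eq: "sa_mgda_gradients f g \<phi> \<tau> Lvv J x0 k = k * (2 + J)"
  unfolding sa_mgda_gradients_def
  by (induction k) (simp_all add: Let_def case_prod_beta sa_mgda_step_eq)

lemma sa_mgda_iterate_in_dom:
  assumes "J \<ge> 1" "k \<ge> 1"
  shows "sa_mgda_iterate f g \<phi> \<tau> Lvv J x0 k \<in> dom_fun f \<times> dom_fun g"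
proof -
  have u: "u_step x \<in> dom_fun f" for x
    unfolding u_step_def
    by (rule subdifferential_subset_dom[OF f_cpc prox_inclusion[OF f_cpc bounded_dom_f \<tau>_pos]])
  have v: "v_map x w \<in> dom_fun g" for x w
    unfolding v_map_def
    by (rule subdifferential_subset_dom[OF g_cpc prox_inclusion[OF g_cpc bounded_dom_g \<eta>_pos]])
  obtain k' J' where "k = Suc k'" "J = Suc J'"
    using assms by (metis One_nat_def Suc_le_D)
  then show ?thesis
    using u v by (simp add: sa_mgda_iterate_Suc Let_def)
qed

lemma norm_diff_le_diameter:
  "x \<in> dom_fun f \<times> dom_fun g \<Longrightarrow> y \<in> dom_fun f \<times> dom_fun g \<Longrightarrow> norm (x - y) \<le> \<Omega>"
  using bounded_dom unfolding bounded_domain_def by blast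

text \<open>The first component of the resolvent is computed exactly, and the inner loop is a Banach
  iteration for the second one, so the error decays geometrically in \<open>J\<close>.\<close>

lemma inner_loop_error:
  "norm ((u_step x, (v_map x ^^ J) (snd x)) - R x) \<le> q ^ J * norm (x - R x)"
proof -
  have "norm ((v_map x ^^ J) (snd x) - snd (R x)) \<le> q ^ J * norm (snd x - snd (R x))"
  proof (induction J)
    case (Suc J)
    have "norm ((v_map x ^^ Suc J) (snd x) - snd (R x))
      = norm (v_map x ((v_map x ^^ J) (snd x)) - v_map x (snd (R x)))"
      by (simp add: v_map_snd_resolvent)
    also have "\<dots> \<le> q * norm ((v_map x ^^ J) (snd x) - snd (R x))"
      by (rule v_map_contraction)
    also have "\<dots> \<le> q * (q ^ J * norm (snd x - snd (R x)))"
      using Suc q_pos by (intro mult_left_mono) auto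
    finally show ?case by (simp add: mult.assoc)
  qed simp
  also have "\<dots> \<le> q ^ J * norm (x - R x)"
    using q_pos norm_snd_le_norm[of "x - R x"] by (intro mult_left_mono) auto
  finally show ?thesis
    by (cases "R x") (use fst_resolvent[of x] in auto)
qed

end

section \<open>Complexity\<close>

text \<open>Telescoping: the smallest of the \<open>s k\<close> is at most their average.\<close>

lemma exists_small_decrement:
  fixes D s :: "nat \<Rightarrow> real"
  assumes step: "\<And>k. D (Suc k) \<le> D k - \<delta> * s k + e" and "D K \<ge> 0"
    and \<delta>: "\<delta> > 0" and K: "K \<ge> 1"
  shows "\<exists>k<K. s k \<le> D 0 / (\<delta> * real K) + e / \<delta>"
proof (rule ccontr)
  define r where "r = D 0 / (\<delta> * real K) + e / \<delta>"
  assume "\<not> ?thesis"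
  then have large: "r < s k" if "k < K" for k
    using that unfolding r_def by (meson not_le)
  have "real K * (\<delta> * r - e) = (\<Sum>k<K. \<delta> * r - e)"
    by simp
  also have "\<dots> < (\<Sum>k<K. \<delta> * s k - e)"
    using large \<delta> K by (intro sum_strict_mono) (auto simp: lessThan_empty_iff)
  also have "\<dots> \<le> (\<Sum>k<K. D k - D (Suc k))"
    by (intro sum_mono) (use step in \<open>simp add: algebra_simps\<close>)
  also have "\<dots> = D 0 - D K"
    by (rule sum_lessThan_telescope')
  also have "\<dots> \<le> real K * (\<delta> * r - e)"
    using \<delta> K \<open>D K \<ge> 0\<close> by (simp add: r_def field_simps)
  finally show False by simp
qed

lemma geometric_power_le:
  fixes q a :: real
  assumes q: "0 < q" "q < 1" and a: "a > 0" and J: "ln (1 / a) / ln (1 / q) \<le> real J"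
  shows "q ^ J \<le> a"
proof -
  have "ln (1 / a) \<le> real J * ln (1 / q)"
    using J q by (simp add: pos_divide_le_eq)
  then have "ln (q ^ J) \<le> ln a"
    using q a by (simp add: ln_div ln_realpow)
  then show ?thesis
    using q a by simp
qed

lemma bigo_at_right_0I:
  fixes F G :: "real \<Rightarrow> real"
  assumes "\<And>\<epsilon>. 0 < \<epsilon> \<Longrightarrow> \<epsilon> < exp (- 1) \<Longrightarrow> \<bar>F \<epsilon>\<bar> \<le> c * \<bar>G \<epsilon>\<bar>"
  shows "F \<in> O[at_right 0](G)"
  by (rule bigoI[of _ c]) (auto simp: eventually_at_right_field intro!: exI[of _ "exp (- 1)"] assms)

context composite_saddle
begin

text \<open>Cocoercivity of \<open>\<nabla>h\<close> gains
  \<open>\<parallel>s\<parallel>\<^sup>2 / (2\<beta>)\<close>, and the weak MVI condition loses at most \<open>\<rho> \<parallel>s\<parallel>\<^sup>2 / 2\<close>,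
  so that there is a net decrease when \<open>\<rho> < 1/\<beta>\<close>.\<close>

lemma resolvent_decrease:
  fixes x xs
  defines "s \<equiv> gradient h x - gradient h (R x)"
  assumes mvi: "\<And>y w. w \<in> M y \<Longrightarrow> (y - xs) \<bullet> w \<ge> - (\<rho> / 2) * (norm w)\<^sup>2"
  shows "bregman h xs (R x) \<le> bregman h xs x - (1 / \<beta> - \<rho>) / 2 * (norm s)\<^sup>2"
proof -
  have "(R x - xs) \<bullet> s \<ge> - (\<rho> / 2) * (norm s)\<^sup>2"
    unfolding s_def by (rule mvi[OF resolvent_inclusion])
  moreover have "bregman h (R x) x \<ge> (norm s)\<^sup>2 / (2 * \<beta>)"
    unfolding s_def by (rule bregman_ge_gradient_diff[OF bregman_nonneg bregman_le \<beta>_pos])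
  moreover have "bregman h xs (R x) = bregman h xs x - bregman h (R x) x - (R x - xs) \<bullet> s"
    unfolding s_def by (rule bregman_three_point)
  ultimately show ?thesis
    by (simp add: algebra_simps diff_divide_distrib)
qed

text \<open>Here \<open>y\<close> is the exact resolvent point and \<open>x\<close> the computed one: the inner error enters the
  potential linearly. With \<open>z\<close> and \<open>x\<close> in the domain, the factor \<open>norm (x - z)\<close> is at most
  \<open>\<Omega>\<close>, which is what the bounded domain provides to the outer analysis.\<close>

lemma bregman_perturbation: "bregman h z x \<le> bregman h z y + \<beta> * norm (x - z) * norm (x - y)"
proof -
  have "- ((x - z) \<bullet> (gradient h y - gradient h x)) \<le> norm (x - z) * norm (gradient h y - gradient h x)"
    using Cauchy_Schwarz_ineq2[of "x - z" "gradient h y - gradient h x"] by linarith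
  also have "\<dots> \<le> norm (x - z) * (\<beta> * norm (x - y))"
    using gradient_resolvent_kernel_lipschitz[of y x]
    by (intro mult_left_mono) (auto simp: norm_minus_commute)
  finally show ?thesis
    using bregman_three_point[of h z x y] bregman_nonneg[of x y] by (simp add: mult_ac)
qed

lemma sa_mgda_complexity:
  fixes x0 :: "'u \<times> 'v" and \<rho> :: real
  assumes mvi: "weak_MVI M \<rho>" and \<rho>: "\<rho> < 1 / \<beta>"
  shows "\<exists>k J :: real \<Rightarrow> nat.
     (\<forall>\<epsilon>>0. J \<epsilon> \<ge> 1 \<and>
        eps_stationary M R \<epsilon> (sa_mgda_iterate f g \<phi> \<tau> Lvv (J \<epsilon>) x0 (k \<epsilon>))) \<and>
     (\<lambda>\<epsilon>. real (k \<epsilon>)) \<in> O[at_right 0](\<lambda>\<epsilon>. 1 / \<epsilon>) \<and>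
     (\<lambda>\<epsilon>. real (J \<epsilon>)) \<in> O[at_right 0](\<lambda>\<epsilon>. ln (1 / \<epsilon>)) \<and>
     (\<lambda>\<epsilon>. real (sa_mgda_gradients f g \<phi> \<tau> Lvv (J \<epsilon>) x0 (k \<epsilon>)))
        \<in> O[at_right 0](\<lambda>\<epsilon>. (1 / \<epsilon>) * ln (1 / \<epsilon>))"
proof -
  obtain xs where "0 \<in> M xs" and xs: "\<And>y w. w \<in> M y \<Longrightarrow> (y - xs) \<bullet> w \<ge> - (\<rho> / 2) * (norm w)\<^sup>2"
    using mvi unfolding weak_MVI_def zeros_def gra_def by auto
  then have xs_dom: "xs \<in> dom_fun f \<times> dom_fun g"
    using saddle_op_in_dom by blast
  have \<Omega>: "\<Omega> \<ge> 0"
    using norm_diff_le_diameter[OF xs_dom xs_dom] by simp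
  define \<delta> where "\<delta> = (1 / \<beta> - \<rho>) / 2"
  have \<delta>: "\<delta> > 0" using \<rho> by (simp add: \<delta>_def)
  \<comment> \<open>The initial point may lie outside the domain, where \<open>\<Omega>\<close> says nothing.\<close>
  define diam where "diam = max \<Omega> (norm (x0 - R x0))"
  \<comment> \<open>The summand \<open>1\<close> makes \<open>C\<close> positive, so that \<open>B\<close> below has a logarithm.\<close>
  define C where "C = \<beta> * \<Omega> * diam + 1"
  have diam: "diam \<ge> 0" using \<Omega> by (simp add: diam_def)
  have C: "C > 0" using \<Omega> \<beta>_pos diam by (simp add: C_def add_nonneg_pos)
  define s where "s x = gradient h x - gradient h (R x)" for x
  let ?x = "\<lambda>J. sa_mgda_iterate f g \<phi> \<tau> Lvv J x0"
  have inexact_decrease: "bregman h xs (?x J (Suc k)) \<le> bregman h xs (?x J k) - \<delta> * (norm (s (?x J k)))\<^sup>2 + q ^ J * C"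
    if J: "J \<ge> 1" for J k
  proof -
    let ?y = "R (?x J k)"
    have diam_bound: "norm (?x J k - ?y) \<le> diam"
    proof (cases "k = 0")
      case False
      then show ?thesis
        using norm_diff_le_diameter[OF sa_mgda_iterate_in_dom[OF J] resolvent_in_dom, of k x0 "?x J k"]
        by (simp add: diam_def)
    qed (simp add: sa_mgda_iterate_0 diam_def)
    have "norm (?x J (Suc k) - ?y) \<le> q ^ J * norm (?x J k - ?y)"
      using inner_loop_error by (simp add: sa_mgda_iterate_Suc Let_def)
    also have "\<dots> \<le> q ^ J * diam"
      using diam_bound q_pos by (intro mult_left_mono) auto
    finally have err: "norm (?x J (Suc k) - ?y) \<le> q ^ J * diam" .
    have "norm (?x J (Suc k) - xs) \<le> \<Omega>"
      using norm_diff_le_diameter sa_mgda_iterate_in_dom[OF J] xs_dom by simp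
    then have "\<beta> * norm (?x J (Suc k) - xs) * norm (?x J (Suc k) - ?y) \<le> \<beta> * \<Omega> * (q ^ J * diam)"
      using err \<beta>_pos \<Omega> by (intro mult_mono) auto
    also have "\<dots> \<le> q ^ J * C"
      using q_pos by (simp add: C_def algebra_simps)
    finally show ?thesis
      using bregman_perturbation[of xs "?x J (Suc k)" ?y] resolvent_decrease[OF xs, of "?x J k"]
      by (simp add: \<delta>_def s_def)
  qed
  \<comment> \<open>\<open>K \<epsilon>\<close> and \<open>J \<epsilon>\<close> make each of the two terms of the averaged bound at most \<open>\<epsilon>/2\<close>.\<close>
  define A where "A = 2 * bregman h xs x0 / \<delta>"
  define B where "B = 2 * C / \<delta>"
  have A: "A \<ge> 0" and B: "B > 0"
    using bregman_nonneg \<delta> C by (auto simp: A_def B_def)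
  define K where "K \<epsilon> = nat \<lceil>A / \<epsilon>\<rceil> + 1" for \<epsilon> :: real
  define J where "J \<epsilon> = nat \<lceil>ln (B / \<epsilon>) / ln (1 / q)\<rceil> + 1" for \<epsilon> :: real
  have "\<exists>k<K \<epsilon>. eps_stationary M R \<epsilon> (?x (J \<epsilon>) k)" if \<epsilon>: "\<epsilon> > 0" for \<epsilon>
  proof -
    have "\<exists>k<K \<epsilon>. (norm (s (?x (J \<epsilon>) k)))\<^sup>2
        \<le> bregman h xs (?x (J \<epsilon>) 0) / (\<delta> * real (K \<epsilon>)) + q ^ J \<epsilon> * C / \<delta>"
    proof (rule exists_small_decrement[where D = "\<lambda>k. bregman h xs (?x (J \<epsilon>) k)"])
      show "bregman h xs (?x (J \<epsilon>) (Suc k))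
        \<le> bregman h xs (?x (J \<epsilon>) k) - \<delta> * (norm (s (?x (J \<epsilon>) k)))\<^sup>2 + q ^ J \<epsilon> * C" for k
        by (rule inexact_decrease) (simp add: J_def)
    qed (simp_all add: bregman_nonneg \<delta> K_def)
    then obtain k where k: "k < K \<epsilon>" and s_le: "(norm (s (?x (J \<epsilon>) k)))\<^sup>2
        \<le> bregman h xs x0 / (\<delta> * real (K \<epsilon>)) + q ^ J \<epsilon> * C / \<delta>"
      by (auto simp: sa_mgda_iterate_0)
    have "A / \<epsilon> \<le> real (K \<epsilon>)"
      unfolding K_def by linarith
    moreover have "real (K \<epsilon>) > 0"
      by (simp add: K_def)
    ultimately have "bregman h xs x0 / (\<delta> * real (K \<epsilon>)) \<le> \<epsilon> / 2"
      using \<epsilon> \<delta> by (simp add: A_def field_simps)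
    moreover have "ln (B / \<epsilon>) / ln (1 / q) \<le> real (J \<epsilon>)"
      unfolding J_def by linarith
    then have "q ^ J \<epsilon> \<le> \<epsilon> / B"
      using \<epsilon> B by (intro geometric_power_le q_pos q_less_1) auto
    then have "q ^ J \<epsilon> * C / \<delta> \<le> \<epsilon> / 2"
      using \<delta> C by (simp add: B_def field_simps)
    ultimately have "(norm (s (?x (J \<epsilon>) k)))\<^sup>2 \<le> \<epsilon>"
      using s_le by linarith
    then have "eps_stationary M R \<epsilon> (?x (J \<epsilon>) k)"
      using closed_saddle_op[OF f_cpc g_cpc] resolvent_inclusion
      by (intro eps_stationaryI[where s = "s (?x (J \<epsilon>) k)"]) (auto simp: s_def)
    with k show ?thesis by blast
  qed
  then obtain k where k: "\<And>\<epsilon>. \<epsilon> > 0 \<Longrightarrow> k \<epsilon> < K \<epsilon> \<and> eps_stationary M R \<epsilon> (?x (J \<epsilon>) (k \<epsilon>))"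
    by metis
  define b where "b = (\<bar>ln B\<bar> + 1) / ln (1 / q) + 2"
  have ln_q: "ln (1 / q) > 0"
    using q_pos q_less_1 by simp
  \<comment> \<open>For \<open>\<epsilon> < exp (-1)\<close> both \<open>1/\<epsilon>\<close> and \<open>ln (1/\<epsilon>)\<close> exceed \<open>1\<close> and absorb the constants.\<close>
  have rates: "real (k \<epsilon>) \<le> (A + 2) * (1 / \<epsilon>)" "real (J \<epsilon>) \<le> b * ln (1 / \<epsilon>)" "1 \<le> ln (1 / \<epsilon>)"
    if \<epsilon>: "0 < \<epsilon>" "\<epsilon> < exp (- 1)" for \<epsilon>
  proof -
    have "ln \<epsilon> < ln (exp (- 1))"
      using \<epsilon> by (subst ln_less_cancel_iff) auto
    then show ln1: "1 \<le> ln (1 / \<epsilon>)"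
      using \<epsilon> by (simp add: ln_div)
    have "\<epsilon> < 1"
      using \<epsilon>(2) by (rule less_trans) simp
    then have "1 \<le> 1 / \<epsilon>"
      using \<epsilon> by simp
    moreover have "real (K \<epsilon>) \<le> A / \<epsilon> + 2"
    proof -
      have "A / \<epsilon> \<ge> 0" using A \<epsilon> by simp
      then show ?thesis unfolding K_def by linarith
    qed
    ultimately show "real (k \<epsilon>) \<le> (A + 2) * (1 / \<epsilon>)"
      using k[OF \<epsilon>(1)] by (simp add: algebra_simps)
    have "ln (B / \<epsilon>) = ln B + ln (1 / \<epsilon>)"
      using B \<epsilon> by (simp add: ln_div)
    also have "\<dots> \<le> (\<bar>ln B\<bar> + 1) * ln (1 / \<epsilon>)"
      using mult_left_mono[OF ln1, of "\<bar>ln B\<bar>"] by (simp add: algebra_simps)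
    finally have "ln (B / \<epsilon>) / ln (1 / q) \<le> (\<bar>ln B\<bar> + 1) / ln (1 / q) * ln (1 / \<epsilon>)"
      using ln_q by (simp only: times_divide_eq_left divide_right_mono less_imp_le)
    moreover have "0 \<le> (\<bar>ln B\<bar> + 1) / ln (1 / q) * ln (1 / \<epsilon>)"
      using ln_q ln1 by (intro mult_nonneg_nonneg divide_nonneg_nonneg) auto
    ultimately have "real (J \<epsilon>) \<le> (\<bar>ln B\<bar> + 1) / ln (1 / q) * ln (1 / \<epsilon>) + 2"
      unfolding J_def by linarith
    then show "real (J \<epsilon>) \<le> b * ln (1 / \<epsilon>)"
      unfolding b_def distrib_right using ln1 by linarith
  qed
  have "(\<lambda>\<epsilon>. real (k \<epsilon>)) \<in> O[at_right 0](\<lambda>\<epsilon>. 1 / \<epsilon>)"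
    by (rule bigo_at_right_0I[of _ "A + 2"]) (use rates in simp)
  moreover have "(\<lambda>\<epsilon>. real (J \<epsilon>)) \<in> O[at_right 0](\<lambda>\<epsilon>. ln (1 / \<epsilon>))"
    by (rule bigo_at_right_0I[of _ b]) (use rates in fastforce)
  moreover have "(\<lambda>\<epsilon>. real (sa_mgda_gradients f g \<phi> \<tau> Lvv (J \<epsilon>) x0 (k \<epsilon>)))
      \<in> O[at_right 0](\<lambda>\<epsilon>. (1 / \<epsilon>) * ln (1 / \<epsilon>))"
  proof (rule bigo_at_right_0I[of _ "(A + 2) * (2 + b)"])
    fix \<epsilon> :: real assume \<epsilon>: "0 < \<epsilon>" "\<epsilon> < exp (- 1)"
    have nonneg: "0 \<le> ln (1 / \<epsilon>)" "0 \<le> 1 / \<epsilon>"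
      using rates(3)[OF \<epsilon>] \<epsilon> by (linarith, simp)
    have "real (2 + J \<epsilon>) \<le> (2 + b) * ln (1 / \<epsilon>)"
      using rates[OF \<epsilon>] by (simp add: algebra_simps)
    then have "real (k \<epsilon>) * real (2 + J \<epsilon>) \<le> ((A + 2) * (1 / \<epsilon>)) * ((2 + b) * ln (1 / \<epsilon>))"
      using rates(1)[OF \<epsilon>] nonneg A by (intro mult_mono mult_nonneg_nonneg) auto
    also have "\<dots> = (A + 2) * (2 + b) * ((1 / \<epsilon>) * ln (1 / \<epsilon>))"
      by (simp add: mult_ac)
    also have "(1 / \<epsilon>) * ln (1 / \<epsilon>) = \<bar>(1 / \<epsilon>) * ln (1 / \<epsilon>)\<bar>"
      using nonneg by (intro abs_of_nonneg[symmetric] mult_nonneg_nonneg)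
    finally show "\<bar>real (sa_mgda_gradients f g \<phi> \<tau> Lvv (J \<epsilon>) x0 (k \<epsilon>))\<bar>
        \<le> (A + 2) * (2 + b) * \<bar>(1 / \<epsilon>) * ln (1 / \<epsilon>)\<bar>"
      by (simp only: sa_mgda_gradients_eq of_nat_mult abs_of_nonneg of_nat_0_le_iff mult_nonneg_nonneg)
  qed
  moreover have "J \<epsilon> \<ge> 1" for \<epsilon>
    by (simp add: J_def)
  ultimately show ?thesis
    using k by blast
qed

end

theorem corollary5p5:
  fixes f :: "'u::euclidean_space \<Rightarrow> ereal"
    and g :: "'v::euclidean_space \<Rightarrow> ereal"
    and \<phi> :: "'u \<times> 'v \<Rightarrow> real"
    and Luu Luv Lvu Lvv L Lhat \<Omega> \<rho> \<tau> :: real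
    and M :: "'u \<times> 'v \<Rightarrow> ('u \<times> 'v) set"
    and R :: "'u \<times> 'v \<Rightarrow> 'u \<times> 'v"
    and x0 :: "'u \<times> 'v"
  defines "Lhat \<equiv> max Luu Lvv"
    and "M \<equiv> saddle_op f g \<phi>"
    and "R \<equiv> resolvent (resolvent_kernel \<tau> \<phi>) M"
  assumes "composite_smooth f g \<phi> Luu Luv Lvu Lvv"
    and "L > 0" and "L-lipschitz_on UNIV (gradient \<phi>)"
    and "\<Omega> \<ge> 0" and "bounded_domain f g \<Omega>"
    and "0 \<le> \<rho>" and "\<rho> < 1 / (2 * L + Lhat)" and "weak_MVI M \<rho>"
    and "\<rho> / (1 - \<rho> * L) < \<tau>" and "\<tau> < 1 / (L + Lhat)"
  shows "\<exists>k J :: real \<Rightarrow> nat.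
     (\<forall>\<epsilon>>0. J \<epsilon> \<ge> 1 \<and>
        eps_stationary M R \<epsilon> (sa_mgda_iterate f g \<phi> \<tau> Lvv (J \<epsilon>) x0 (k \<epsilon>))) \<and>
     (\<lambda>\<epsilon>. real (k \<epsilon>)) \<in> O[at_right 0](\<lambda>\<epsilon>. 1 / \<epsilon>) \<and>
     (\<lambda>\<epsilon>. real (J \<epsilon>)) \<in> O[at_right 0](\<lambda>\<epsilon>. ln (1 / \<epsilon>)) \<and>
     (\<lambda>\<epsilon>. real (sa_mgda_gradients f g \<phi> \<tau> Lvv (J \<epsilon>) x0 (k \<epsilon>)))
        \<in> O[at_right 0](\<lambda>\<epsilon>. (1 / \<epsilon>) * ln (1 / \<epsilon>))"
proof -
  have "Lhat > 0"
    using assms(4) by (auto simp: Lhat_def composite_smooth_def less_max_iff_disj)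
  then have "\<rho> * (2 * L + Lhat) < 1"
    using \<open>\<rho> < 1 / (2 * L + Lhat)\<close> \<open>L > 0\<close> by (simp add: pos_less_divide_eq)
  moreover have "\<rho> * L \<le> \<rho> * (2 * L + Lhat)"
    using \<open>0 \<le> \<rho>\<close> \<open>L > 0\<close> \<open>Lhat > 0\<close> by (intro mult_left_mono) auto
  ultimately have pos: "1 - \<rho> * L > 0"
    by simp
  then have "0 \<le> \<rho> / (1 - \<rho> * L)"
    using \<open>0 \<le> \<rho>\<close> by simp
  then have \<tau>: "\<tau> > 0"
    using \<open>\<rho> / (1 - \<rho> * L) < \<tau>\<close> by linarith
  interpret composite_saddle f g \<phi> Luu Luv Lvu Lvv L \<Omega> \<tau>
    using assms \<tau> by unfold_locales (auto simp: Lhat_def)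
  \<comment> \<open>The lower bound on \<open>\<tau>\<close> is the condition \<open>\<rho> \<beta> < 1\<close> in disguise.\<close>
  have "\<rho> < \<tau> * (1 - \<rho> * L)"
    using \<open>\<rho> / (1 - \<rho> * L) < \<tau>\<close> pos by (simp add: pos_divide_less_eq)
  then have "\<rho> * \<beta> < 1"
    using \<tau> by (simp add: \<beta>_def field_simps)
  then have "\<rho> < 1 / \<beta>"
    using \<beta>_pos by (simp add: pos_less_divide_eq)
  moreover have "weak_MVI (saddle_op f g \<phi>) \<rho>"
    using \<open>weak_MVI M \<rho>\<close> by (simp add: M_def)
  ultimately show ?thesis
    unfolding R_def M_def by (rule sa_mgda_complexity[rotated])
qed

end
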